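(* Let $G$ be a bipartite graph with $q$ edges that admits a near $\alpha$-labeling $f_G$ with respect to a partition $V(G)=A_G\cup B_G$; identify each vertex of $G$ with its label under $f_G$. Let $n\ge1$ and let $A,B\subset[0,n]$ be fixed disjoint sets. Let $\Gamma$ be a family of bipartite graphs such that every $F\in\Gamma$ has exactly $n$ edges and admits a near $\alpha$-labeling $f_F$ with respect to a partition of $V(F)$ into two parts that $f_F$ maps onto $A$ and $B$, respectively (every edge joins the part mapped to $A$ with the part mapped to $B$, the endpoint in the $A$-part having the smaller label), where $A$ and $B$ do not depend on $F$; identify each vertex of $F$ with its label under $f_F$, so that $V(F)=A\cup B$ for every $F\in\Gamma$. Let $h:E(G)\to\Gamma$ be any function. Then the graph $G\bar\otimes_h\Gamma$ admits a near $\alpha$-labeling.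
   Context: For a graph $G$ with $q$ edges, a graceful labeling is an injective map $f:V(G)\to[0,q]$ (integer interval) such that the edge labels $|f(u)-f(v)|$, $uv\in E(G)$, are pairwise distinct. A graceful labeling $f$ is a near $\alpha$-labeling if there is a partition $V(G)=A\cup B$ such that every edge of $G$ has the form $uv$ with $u\in A$, $v\in B$ and $f(u)<f(v)$. The weak $\otimes_h$-product: given a bipartite graph $G$ with vertex partition $(A_G,B_G)$ into stable sets, a family $\Gamma$ of bipartite graphs all having vertex set $A\cup B$ with stable sets $A$ and $B$, and a function $h:E(G)\to\Gamma$, the graph $G\bar\otimes_h\Gamma$ has vertex set $(A_G\times A)\cup(B_G\times B)$, and $(a,x)\in A_G\times A$ is adjacent to $(b,y)\in B_G\times B$ if and only if $ab\in E(G)$ and $xy\in E(h(ab))$. *)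

theory Defs
  imports Main "HOL-Library.FuncSet"
begin

record 'a graph =
  verts :: "'a set"
  edges :: "'a set set"

definition simple_graph :: "'a graph \<Rightarrow> bool" where
  "simple_graph G \<longleftrightarrow>
     finite (verts G) \<and> (\<forall>e \<in> edges G. e \<subseteq> verts G \<and> card e = 2)"

definition stable_set :: "'a graph \<Rightarrow> 'a set \<Rightarrow> bool" where
  "stable_set G S \<longleftrightarrow> S \<subseteq> verts G \<and> (\<forall>u \<in> S. \<forall>v \<in> S. {u, v} \<notin> edges G)"

definition bipartition :: "'a graph \<Rightarrow> 'a set \<Rightarrow> 'a set \<Rightarrow> bool" where
  "bipartition G A B \<longleftrightarrow>
     A \<union> B = verts G \<and> A \<inter> B = {} \<and> stable_set G A \<and> stable_set G B"

definition bipartite :: "'a graph \<Rightarrow> bool" where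
  "bipartite G \<longleftrightarrow> simple_graph G \<and> (\<exists>A B. bipartition G A B)"

definition graceful_labeling :: "'a graph \<Rightarrow> ('a \<Rightarrow> nat) \<Rightarrow> bool" where
  "graceful_labeling G f \<longleftrightarrow>
     inj_on f (verts G) \<and>
     f ` verts G \<subseteq> {0..card (edges G)} \<and>
     (\<forall>u v u' v'. {u, v} \<in> edges G \<and> {u', v'} \<in> edges G \<and>
        \<bar>int (f u) - int (f v)\<bar> = \<bar>int (f u') - int (f v')\<bar> \<longrightarrow> {u, v} = {u', v'})"

text \<open>
  As usual for partitions, the two parts are required to be nonempty. This is automatic as
  soon as there is an edge; it only excludes the edgeless graphs with at most one vertex.
  For these the product theorem would fail: a product of a single vertex with a family of
  graphs on \<open>A \<union> B\<close> consists of isolated vertices and can have more than one of them.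
\<close>

definition near_alpha_labeling ::
    "'a graph \<Rightarrow> 'a set \<Rightarrow> 'a set \<Rightarrow> ('a \<Rightarrow> nat) \<Rightarrow> bool" where
  "near_alpha_labeling G A B f \<longleftrightarrow>
     graceful_labeling G f \<and>
     A \<union> B = verts G \<and> A \<inter> B = {} \<and> A \<noteq> {} \<and> B \<noteq> {} \<and>
     (\<forall>e \<in> edges G. \<exists>u \<in> A. \<exists>v \<in> B. e = {u, v} \<and> f u < f v)"

definition admits_near_alpha_labeling :: "'a graph \<Rightarrow> bool" where
  "admits_near_alpha_labeling G \<longleftrightarrow> (\<exists>A B f. near_alpha_labeling G A B f)"

text \<open>Identification of the vertices of a graph with their labels.\<close>

definition relabel :: "('a \<Rightarrow> 'b) \<Rightarrow> 'a graph \<Rightarrow> 'b graph" where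
  "relabel f G = \<lparr>verts = f ` verts G, edges = (`) f ` edges G\<rparr>"

text \<open>
  The weak product of \<open>G\<close>, with stable sets \<open>AG\<close> and \<open>BG\<close>, by graphs \<open>h e\<close>, one for each
  edge \<open>e\<close> of \<open>G\<close>, that have the common stable sets \<open>A\<close> and \<open>B\<close>.
\<close>

definition weak_product ::
    "'a graph \<Rightarrow> 'a set \<Rightarrow> 'a set \<Rightarrow> 'b set \<Rightarrow> 'b set \<Rightarrow> ('a set \<Rightarrow> 'b graph) \<Rightarrow> ('a \<times> 'b) graph"
where
  "weak_product G AG BG A B h =
     \<lparr>verts = AG \<times> A \<union> BG \<times> B,
      edges = {{(a, x), (b, y)} | a x b y.
        a \<in> AG \<and> x \<in> A \<and> b \<in> BG \<and> y \<in> B \<and>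
        {a, b} \<in> edges G \<and> {x, y} \<in> edges (h {a, b})}\<rparr>"

lemma bipartition_weak_product:
  assumes "AG \<inter> BG = {}"
  shows "bipartition (weak_product G AG BG A B h) (AG \<times> A) (BG \<times> B)"
  using assms
  by (auto simp: bipartition_def stable_set_def weak_product_def doubleton_eq_iff)

lemma bipartite_weak_product:
  assumes "AG \<inter> BG = {}" "finite AG" "finite BG" "finite A" "finite B"
  shows "bipartite (weak_product G AG BG A B h)"
proof -
  have "simple_graph (weak_product G AG BG A B h)"
    using assms by (auto simp: simple_graph_def weak_product_def card_2_iff) blast+
  then show ?thesis
    using bipartition_weak_product[OF assms(1)] unfolding bipartite_def by blast
qed

end

theory Submission imports Defs begin

text \<open>
  Scale the labels of \<open>G\<close> by \<open>n\<close>: send \<open>(a, x)\<close> to \<open>n f(a) + x\<close> and \<open>(b, y)\<close> to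
  \<open>n (f(b) - 1) + y\<close>. An edge of \<open>G\<close> with label \<open>d\<close> combined with an edge of \<open>h(ab)\<close> with
  label \<open>k \<in> [1, n]\<close> then gets label \<open>n (d - 1) + k\<close>, so that all labels in \<open>[1, nq]\<close> occur
  exactly once. Since the largest edge label of a near \<open>\<alpha>\<close>-labeling can only be
  attained between the extreme vertex labels, \<open>A \<subseteq> [0, n - 1]\<close> and \<open>B \<subseteq> [1, n]\<close>, and
  likewise for \<open>G\<close>; this makes the vertex labels distinct.
\<close>

section \<open>A criterion with oriented edges\<close>

text \<open>Every edge can be written from \<open>A\<close> to \<open>B\<close> with increasing
  labels, so absolute values over the integers become natural differences that truncation does not
  affect. Distinctness of edge labels then has to be checked for oriented pairs only.\<close>

lemma near_alpha_labelingI: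
  assumes "inj_on f (verts G)" "f ` verts G \<subseteq> {0..card (edges G)}"
    and "A \<union> B = verts G" "A \<inter> B = {}" "A \<noteq> {}" "B \<noteq> {}"
    and edge: "\<And>e. e \<in> edges G \<Longrightarrow> \<exists>u\<in>A. \<exists>v\<in>B. e = {u, v} \<and> f u < f v"
    and uniq: "\<And>a b a' b'. \<lbrakk>a \<in> A; b \<in> B; a' \<in> A; b' \<in> B; {a, b} \<in> edges G; {a', b'} \<in> edges G;
       f a < f b; f a' < f b'; f b - f a = f b' - f a'\<rbrakk> \<Longrightarrow> {a, b} = {a', b'}"
  shows "near_alpha_labeling G A B f"
proof -
  have "{u, v} = {u', v'}"
    if e: "{u, v} \<in> edges G" and e': "{u', v'} \<in> edges G"
      and eq: "\<bar>int (f u) - int (f v)\<bar> = \<bar>int (f u') - int (f v')\<bar>" for u v u' v'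
  proof -
    obtain a b where ab: "a \<in> A" "b \<in> B" "{u, v} = {a, b}" "f a < f b"
      using edge[OF e] by blast
    obtain a' b' where ab': "a' \<in> A" "b' \<in> B" "{u', v'} = {a', b'}" "f a' < f b'"
      using edge[OF e'] by blast
    have "\<bar>int (f u) - int (f v)\<bar> = int (f b - f a)"
      using ab by (auto simp: doubleton_eq_iff)
    moreover have "\<bar>int (f u') - int (f v')\<bar> = int (f b' - f a')"
      using ab' by (auto simp: doubleton_eq_iff)
    ultimately have "f b - f a = f b' - f a'"
      using eq by linarith
    then show ?thesis
      using uniq[of a b a' b'] ab ab' e e' by simp
  qed
  then have "graceful_labeling G f"
    unfolding graceful_labeling_def using assms(1,2) by (intro conjI allI impI) auto
  then show ?thesis
    unfolding near_alpha_labeling_def using assms(3-6) edge by simp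
qed

section \<open>Edge labels and extreme vertex labels of a near \<alpha>-labeling\<close>

context
  fixes G :: "'a graph" and A B f
  assumes near_alpha: "near_alpha_labeling G A B f"
begin

lemma near_alpha_graceful: "graceful_labeling G f"
  and near_alpha_parts: "A \<union> B = verts G" "A \<inter> B = {}" "A \<noteq> {}" "B \<noteq> {}"
  and near_alpha_edge: "e \<in> edges G \<Longrightarrow> \<exists>u\<in>A. \<exists>v\<in>B. e = {u, v} \<and> f u < f v"
  using near_alpha unfolding near_alpha_labeling_def by simp_all

lemma near_alpha_inj: "inj_on f (A \<union> B)"
  using near_alpha_graceful near_alpha_parts(1) unfolding graceful_labeling_def by simp

lemma near_alpha_le:
  assumes "v \<in> A \<union> B"
  shows "f v \<le> card (edges G)"
proof -
  have "f ` (A \<union> B) \<subseteq> {0..card (edges G)}"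
    using near_alpha_graceful near_alpha_parts(1) unfolding graceful_labeling_def by simp
  then show ?thesis
    using assms by auto
qed

lemma near_alpha_less:
  assumes "a \<in> A" "b \<in> B" "{a, b} \<in> edges G"
  shows "f a < f b"
  using near_alpha_edge[OF assms(3)] assms(1,2) near_alpha_parts(2)
  by (auto simp: doubleton_eq_iff)

lemma near_alpha_unique:
  assumes "a \<in> A" "b \<in> B" "{a, b} \<in> edges G" "a' \<in> A" "b' \<in> B" "{a', b'} \<in> edges G"
    and "f b - f a = f b' - f a'"
  shows "a = a'" "b = b'"
proof -
  have "\<bar>int (f a) - int (f b)\<bar> = \<bar>int (f a') - int (f b')\<bar>"
    using near_alpha_less[OF assms(1-3)] near_alpha_less[OF assms(4-6)] assms(7) by linarith
  then have "{a, b} = {a', b'}"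
    using near_alpha_graceful assms(3,6) unfolding graceful_labeling_def by blast
  then show "a = a'" "b = b'"
    using assms(1,2,4,5) near_alpha_parts(2) by (auto simp: doubleton_eq_iff)
qed

lemma near_alpha_finite: "finite (A \<union> B)"
proof (rule finite_imageD[OF _ near_alpha_inj])
  show "finite (f ` (A \<union> B))"
    by (rule finite_subset[of _ "{..card (edges G)}"]) (use near_alpha_le in auto)
qed

text \<open>Pigeonhole: each edge has an orientation in \<open>S\<close>, and \<open>d\<close> maps
  \<open>S\<close> injectively into the labels from 1 to \<open>card (edges G)\<close>, so no label
  is left out.\<close>

lemma near_alpha_surj:
  assumes "1 \<le> k" "k \<le> card (edges G)"
  obtains a b where "a \<in> A" "b \<in> B" "{a, b} \<in> edges G" "f b = f a + k"
proof -
  define S where "S = {(a, b) \<in> A \<times> B. {a, b} \<in> edges G}"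
  define d where "d = (\<lambda>(a, b). f b - f a)"
  have fin: "finite S"
    using near_alpha_finite by (auto simp: S_def intro: finite_subset[of _ "A \<times> B"])
  have "edges G \<subseteq> (\<lambda>(a, b). {a, b}) ` S"
    using near_alpha_edge by (force simp: S_def)
  then have "card (edges G) \<le> card S"
    by (rule surj_card_le[OF fin])
  also have "card S = card (d ` S)"
    by (rule card_image[symmetric])
       (use near_alpha_unique in \<open>auto simp: inj_on_def S_def d_def\<close>)
  finally have card: "card (edges G) \<le> card (d ` S)" .
  have "f b - f a \<in> {1..card (edges G)}" if "(a, b) \<in> S" for a b
    using that near_alpha_less[of a b] near_alpha_le[of b] by (auto simp: S_def)
  then have "d ` S \<subseteq> {1..card (edges G)}"
    by (auto simp: d_def)
  then have "d ` S = {1..card (edges G)}"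
    using card by (intro card_seteq) auto
  then have "k \<in> d ` S"
    using assms by simp
  then obtain a b where "a \<in> A" "b \<in> B" "{a, b} \<in> edges G" "k = f b - f a"
    by (auto simp: S_def d_def)
  with near_alpha_less[of a b] show thesis
    by (intro that) auto
qed

text \<open>The nonempty disjoint parts supply two distinct vertices; with edge count 0 both would
  have label 0, against injectivity.\<close>

lemma near_alpha_card_pos: "card (edges G) \<ge> 1"
proof (rule ccontr)
  assume "\<not> card (edges G) \<ge> 1"
  then have zero: "f v = 0" if "v \<in> A \<union> B" for v
    using near_alpha_le[OF that] by simp
  obtain a b where "a \<in> A" "b \<in> B"
    using near_alpha_parts by blast
  then have "a = b"
    using zero inj_onD[OF near_alpha_inj, of a b] by simp
  with \<open>a \<in> A\<close> \<open>b \<in> B\<close> show False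
    using near_alpha_parts(2) by blast
qed

lemma near_alpha_bounds:
  shows "a \<in> A \<Longrightarrow> f a < card (edges G)" and "b \<in> B \<Longrightarrow> 1 \<le> f b"
proof -
  obtain a0 b0 where *: "a0 \<in> A" "b0 \<in> B" "f b0 = f a0 + card (edges G)"
    using near_alpha_surj[OF near_alpha_card_pos order_refl] by blast
  then have ext: "f a0 = 0" "f b0 = card (edges G)"
    using near_alpha_le[of b0] by auto
  show "f a < card (edges G)" if "a \<in> A"
  proof -
    have "a \<noteq> b0"
      using that * near_alpha_parts(2) by blast
    then have "f a \<noteq> f b0"
      using that * inj_onD[OF near_alpha_inj, of a b0] by blast
    then show ?thesis
      using near_alpha_le[of a] that ext by simp
  qed
  show "1 \<le> f b" if "b \<in> B"
  proof -
    have "b \<noteq> a0"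
      using that * near_alpha_parts(2) by blast
    then have "f b \<noteq> f a0"
      using that * inj_onD[OF near_alpha_inj, of b a0] by blast
    then show ?thesis
      using ext by simp
  qed
qed

section \<open>Identifying vertices with their labels\<close>

lemma near_alpha_edges_subset: "edges G \<subseteq> Pow (A \<union> B)"
proof
  show "e \<in> Pow (A \<union> B)" if "e \<in> edges G" for e
    using near_alpha_edge[OF that] by auto
qed

lemma card_edges_relabel: "card (edges (relabel f G)) = card (edges G)"
  using inj_on_subset[OF inj_on_image_Pow[OF near_alpha_inj] near_alpha_edges_subset]
  by (simp add: relabel_def card_image)

text \<open>This brings different graphs with the same label sets onto common parts with a common
  labeling, as the product construction requires.\<close>

lemma near_alpha_relabel: "near_alpha_labeling (relabel f G) (f ` A) (f ` B) (\<lambda>x. x)"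
proof (rule near_alpha_labelingI)
  \<comment> \<open>Injectivity of \<open>f\<close> lifts to sets of vertices, so an edge of the
    relabeled graph comes from exactly the expected pair.\<close>
  have mem: "{a, b} \<in> edges G"
    if ab: "a \<in> A" "b \<in> B" and ab_edge: "{f a, f b} \<in> edges (relabel f G)" for a b
  proof -
    obtain e where e: "e \<in> edges G" "f ` {a, b} = f ` e"
      using ab_edge by (auto simp: relabel_def)
    then have "e = {a, b}"
      using near_alpha_edges_subset ab
      by (subst (asm) inj_on_image_eq_iff[OF near_alpha_inj]) auto
    with e show ?thesis
      by simp
  qed
  show "{x, y} = {x', y'}"
    if xy: "x \<in> f ` A" "y \<in> f ` B" "x' \<in> f ` A" "y' \<in> f ` B"
      and e: "{x, y} \<in> edges (relabel f G)" "{x', y'} \<in> edges (relabel f G)"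
      and eq: "y - x = y' - x'" for x y x' y'
  proof -
    obtain a b a' b' where [simp]: "x = f a" "y = f b" "x' = f a'" "y' = f b'"
      and ab: "a \<in> A" "b \<in> B" "a' \<in> A" "b' \<in> B"
      using xy by blast
    have "a = a'" "b = b'"
      using near_alpha_unique[of a b a' b'] mem e eq ab by simp_all
    then show ?thesis
      by simp
  qed
  show "(\<lambda>x. x) ` verts (relabel f G) \<subseteq> {0..card (edges (relabel f G))}"
    unfolding card_edges_relabel
    using near_alpha_le near_alpha_parts(1) by (auto simp: relabel_def)
  show "f ` A \<inter> f ` B = {}"
    using near_alpha_inj near_alpha_parts(2)
    by (metis image_empty inj_on_image_Int sup_ge1 sup_ge2)
  show "\<exists>u\<in>f ` A. \<exists>v\<in>f ` B. e = {u, v} \<and> u < v" if "e \<in> edges (relabel f G)" for e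
    using that near_alpha_edge by (fastforce simp: relabel_def)
qed (use near_alpha_parts in \<open>auto simp: relabel_def\<close>)

end

section \<open>The labeling of the product\<close>

lemma mult_add_eqD:
  fixes n i j x y :: nat
  assumes "n * i + x = n * j + y" "x < n" "y < n"
  shows "i = j" "x = y"
proof -
  have "(n * i + x) div n = (n * j + y) div n" "(n * i + x) mod n = (n * j + y) mod n"
    using assms(1) by simp_all
  then show "i = j" "x = y"
    using assms(2,3) by simp_all
qed

text \<open>One labeling \<open>g\<close> serves all graphs \<open>H e\<close>, so the label of a
  product vertex does not depend on the edge of \<open>G\<close> through which it is
  reached.\<close>

lemma near_alpha_weak_product:
  fixes G :: "'a graph" and H :: "'a set \<Rightarrow> 'b graph"
  assumes G: "near_alpha_labeling G AG BG f"
    and H: "\<And>e. e \<in> edges G \<Longrightarrow> near_alpha_labeling (H e) A B g"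
    and card_H: "\<And>e. e \<in> edges G \<Longrightarrow> card (edges (H e)) = n"
  shows "near_alpha_labeling (weak_product G AG BG A B H) (AG \<times> A) (BG \<times> B)
           (\<lambda>(v, x). if v \<in> AG then n * f v + g x else n * (f v - 1) + g x)"
    (is "near_alpha_labeling ?P _ _ ?L")
proof -
  define q where "q = card (edges G)"
  define L where "L = ?L"
  have disj_G: "AG \<inter> BG = {}"
    using near_alpha_parts[OF G] by simp
  have L_A: "L (a, x) = n * f a + g x" if "a \<in> AG" for a x
    using that by (simp add: L_def)
  have L_B: "L (b, y) = n * (f b - 1) + g y" if "b \<in> BG" for b y
    using that disj_G by (auto simp: L_def)
  \<comment> \<open>The bounds on \<open>g\<close> and its injectivity concern only
    \<open>A\<close>, \<open>B\<close> and \<open>n\<close>, so they can be read off a single member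
    of the family.\<close>
  obtain e0 where e0: "e0 \<in> edges G"
    using near_alpha_card_pos[OF G] by (metis all_not_in_conv card.empty not_one_le_zero)
  note H0 = H[OF e0]
  have g_A: "g x < n" if "x \<in> A" for x
    using near_alpha_bounds(1)[OF H0 that] card_H[OF e0] by simp
  have g_B: "1 \<le> g y" "g y \<le> n" if "y \<in> B" for y
    using near_alpha_bounds(2)[OF H0 that] near_alpha_le[OF H0, of y] that card_H[OF e0] by auto
  have f_A: "f a < q" if "a \<in> AG" for a
    using near_alpha_bounds(1)[OF G that] by (simp add: q_def)
  have f_B: "1 \<le> f b" "f b \<le> q" if "b \<in> BG" for b
    using near_alpha_bounds(2)[OF G that] near_alpha_le[OF G, of b] that by (auto simp: q_def)
  have f_inj: "u = v" if "f u = f v" "u \<in> AG \<union> BG" "v \<in> AG \<union> BG" for u v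
    using inj_onD[OF near_alpha_inj[OF G]] that by blast
  have g_inj: "x = y" if "g x = g y" "x \<in> A \<union> B" "y \<in> A \<union> B" for x y
    using inj_onD[OF near_alpha_inj[OF H0]] that by blast
  have edge_label: "L (b, y) - L (a, x) = n * (f b - f a - 1) + (g y - g x)"
    "L (a, x) < L (b, y)" "f a < f b" "g x < g y"
    if ab: "a \<in> AG" "b \<in> BG" "{a, b} \<in> edges G"
      and xy: "x \<in> A" "y \<in> B" "{x, y} \<in> edges (H {a, b})" for a b x y
  proof -
    show *: "f a < f b" "g x < g y"
      using near_alpha_less[OF G ab] near_alpha_less[OF H[OF ab(3)] xy] .
    \<comment> \<open>Additive forms avoid truncated subtraction: \<open>f b - 1\<close> becomes
      \<open>f a + d\<close>, and the product edge gets the label \<open>n * d + k\<close>.\<close>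
    then obtain d k where "f b = f a + d + 1" "g y = g x + k" "k > 0"
      by (metis less_imp_add_positive less_iff_Suc_add Suc_eq_plus1 add_Suc_right)
    then show "L (b, y) - L (a, x) = n * (f b - f a - 1) + (g y - g x)" "L (a, x) < L (b, y)"
      using ab by (simp_all add: L_A L_B algebra_simps)
  qed
  have edgeI: "{(a, x), (b, y)} \<in> edges ?P"
    if "a \<in> AG" "b \<in> BG" "{a, b} \<in> edges G" "x \<in> A" "y \<in> B" "{x, y} \<in> edges (H {a, b})"
    for a b x y
    using that unfolding weak_product_def by auto
  have edgeD: "\<exists>a x b y. e = {(a, x), (b, y)} \<and> a \<in> AG \<and> b \<in> BG \<and> {a, b} \<in> edges G \<and>
      x \<in> A \<and> y \<in> B \<and> {x, y} \<in> edges (H {a, b})" if "e \<in> edges ?P" for e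
    using that unfolding weak_product_def by auto
  have edgeD': "{a, b} \<in> edges G \<and> {x, y} \<in> edges (H {a, b})"
    if "{(a, x), (b, y)} \<in> edges ?P" "a \<in> AG" "b \<in> BG" for a b x y
    using edgeD[OF that(1)] that(2,3) disj_G by (auto simp: doubleton_eq_iff)
  \<comment> \<open>Only this inequality is required to keep the vertex labels, which are at most
    \<open>n * q\<close>, in the permitted range.\<close>
  have card_P: "n * q \<le> card (edges ?P)"
  proof -
    \<comment> \<open>Maximum minus minimum gives the label of an unordered edge without choosing an
      orientation.\<close>
    define lab where "lab e = Max (L ` e) - Min (L ` e)" for e
    have "edges ?P \<subseteq> Pow ((AG \<union> BG) \<times> (A \<union> B))"
      by (auto dest!: edgeD)
    then have fin: "finite (edges ?P)"
      using near_alpha_finite[OF G] near_alpha_finite[OF H0]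
      by (meson finite_Pow_iff finite_SigmaI finite_subset)
    have "Suc m \<in> lab ` edges ?P" if "m < n * q" for m
    proof -
      have "n > 0"
        using that by (cases n) auto
      \<comment> \<open>For the label \<open>m + 1\<close>, the quotient of \<open>m\<close> by
        \<open>n\<close> selects the edge of \<open>G\<close> and the remainder selects the edge of
        \<open>H {a, b}\<close>; both labels are shifted by one because edge labels start at
        1.\<close>
      have "m div n < q"
        using that by (simp add: less_mult_imp_div_less mult.commute)
      then obtain a b where ab: "a \<in> AG" "b \<in> BG" "{a, b} \<in> edges G" "f b = f a + (m div n + 1)"
        using near_alpha_surj[OF G, of "m div n + 1"] by (auto simp: q_def)
      have "m mod n < n"
        using \<open>n > 0\<close> by simp
      then obtain x y where xy: "x \<in> A" "y \<in> B" "{x, y} \<in> edges (H {a, b})"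
          "g y = g x + (m mod n + 1)"
        using near_alpha_surj[OF H[OF ab(3)], of "m mod n + 1"] card_H[OF ab(3)] by auto
      have "L (b, y) - L (a, x) = m + 1"
        using edge_label(1)[OF ab(1-3) xy(1-3)] ab(4) xy(4) by simp
      then have "lab {(a, x), (b, y)} = m + 1"
        using edge_label(2)[OF ab(1-3) xy(1-3)] by (simp add: lab_def)
      then show ?thesis
        using edgeI[OF ab(1-3) xy(1-3)] by (intro image_eqI[of _ _ "{(a, x), (b, y)}"]) simp_all
    qed
    then have "Suc ` {..<n * q} \<subseteq> lab ` edges ?P"
      by auto
    then have "card (Suc ` {..<n * q}) \<le> card (edges ?P)"
      by (rule surj_card_le[OF fin])
    then show ?thesis
      by (simp add: card_image)
  qed
  have cross: "L (a, x) \<noteq> L (b, y)" if "a \<in> AG" "x \<in> A" "b \<in> BG" "y \<in> B" for a x b y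
  proof
    assume "L (a, x) = L (b, y)"
    then have eq: "n * f a + g x = n * (f b - 1) + g y"
      using that by (simp add: L_A L_B)
    show False
    \<comment> \<open>The value \<open>n\<close> is not a remainder modulo \<open>n\<close>: it
      carries over and cancels the shift in \<open>f b - 1\<close>, which forces
      \<open>f a = f b\<close>. Any smaller value is a remainder and forces
      \<open>g x = g y\<close>.\<close>
    proof (cases "g y = n")
      case True
      then have "n * f a + g x = n * f b + 0"
        using eq f_B(1)[of b] that by (cases "f b") auto
      then have "f a = f b"
        using mult_add_eqD(1)[of n "f a" "g x" "f b" 0] g_A[of x] that by linarith
      then show False
        using f_inj[of a b] that disj_G by blast
    next
      case False
      then have "g x = g y"
        using mult_add_eqD(2)[OF eq] g_A[of x] g_B(2)[of y] that by linarith
      then show False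
        using g_inj[of x y] that near_alpha_parts(2)[OF H0] by blast
    qed
  qed
  have same_A: "a = a' \<and> x = x'"
    if "L (a, x) = L (a', x')" "a \<in> AG" "x \<in> A" "a' \<in> AG" "x' \<in> A" for a x a' x'
    using that mult_add_eqD[of n "f a" "g x" "f a'" "g x'"] g_A f_inj[of a a'] g_inj[of x x']
    by (simp add: L_A)
  have same_B: "b = b' \<and> y = y'"
    if "L (b, y) = L (b', y')" "b \<in> BG" "y \<in> B" "b' \<in> BG" "y' \<in> B" for b y b' y'
  proof -
    \<comment> \<open>On \<open>B\<close> the values of \<open>g\<close> lie between 1 and
      \<open>n\<close>; subtracting 1 turns them into remainders.\<close>
    have "n * (f b - 1) + (g y - 1) = n * (f b' - 1) + (g y' - 1)"
      using that g_B(1)[of y] g_B(1)[of y'] by (simp add: L_B)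
    then have "f b - 1 = f b' - 1" "g y - 1 = g y' - 1"
      using mult_add_eqD[of n "f b - 1" "g y - 1" "f b' - 1" "g y' - 1"]
        that g_B[of y] g_B[of y'] by linarith+
    then have "f b = f b'" "g y = g y'"
      using that g_B(1)[of y] g_B(1)[of y'] f_B(1)[of b] f_B(1)[of b'] by linarith+
    then show ?thesis
      using that f_inj g_inj by blast
  qed
  have "near_alpha_labeling ?P (AG \<times> A) (BG \<times> B) L"
  proof (rule near_alpha_labelingI)
    show "inj_on L (verts ?P)"
    proof (rule inj_onI)
      fix p r
      assume "p \<in> verts ?P" "r \<in> verts ?P" "L p = L r"
      moreover obtain v x w y where "p = (v, x)" "r = (w, y)"
        by (meson surj_pair)
      ultimately show "p = r"
        using same_A[of v x w y] same_B[of v x w y] cross[of v x w y] cross[of w y v x]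
        by (auto simp: weak_product_def)
    qed
    have "L (a, x) \<le> n * q" if "a \<in> AG" "x \<in> A" for a x
    proof -
      have "n * (f a + 1) \<le> n * q"
        using f_A[OF that(1)] by (intro mult_left_mono) auto
      then show ?thesis
        using g_A[OF that(2)] that by (simp add: L_A)
    qed
    moreover have "L (b, y) \<le> n * q" if "b \<in> BG" "y \<in> B" for b y
    proof -
      have "n * (f b - 1 + 1) \<le> n * q"
        using f_B[OF that(1)] by (intro mult_left_mono) auto
      then show ?thesis
        using g_B(2)[OF that(2)] that by (simp add: L_B)
    qed
    ultimately show "L ` verts ?P \<subseteq> {0..card (edges ?P)}"
      using card_P by (fastforce simp: weak_product_def)
    show "\<exists>u\<in>AG \<times> A. \<exists>v\<in>BG \<times> B. e = {u, v} \<and> L u < L v" if "e \<in> edges ?P" for e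
      using edgeD[OF that] edge_label(2) by blast
    show "{p, r} = {p', r'}"
      if mem: "p \<in> AG \<times> A" "r \<in> BG \<times> B" "p' \<in> AG \<times> A" "r' \<in> BG \<times> B"
        and e: "{p, r} \<in> edges ?P" "{p', r'} \<in> edges ?P" and eq: "L r - L p = L r' - L p'"
      for p r p' r'
    proof -
      obtain a x b y a' x' b' y' where pr: "p = (a, x)" "r = (b, y)" "p' = (a', x')" "r' = (b', y')"
        by (meson surj_pair)
      have ab: "a \<in> AG" "b \<in> BG" "{a, b} \<in> edges G"
        and xy: "x \<in> A" "y \<in> B" "{x, y} \<in> edges (H {a, b})"
        using mem e(1) edgeD' unfolding pr by blast+
      have ab': "a' \<in> AG" "b' \<in> BG" "{a', b'} \<in> edges G"
        and xy': "x' \<in> A" "y' \<in> B" "{x', y'} \<in> edges (H {a', b'})"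
        using mem e(2) edgeD' unfolding pr by blast+
      note lt = edge_label(3,4)[OF ab xy] edge_label(3,4)[OF ab' xy']
      have "n * (f b - f a - 1) + (g y - g x) = n * (f b' - f a' - 1) + (g y' - g x')"
        using eq edge_label(1)[OF ab xy] edge_label(1)[OF ab' xy'] by (simp add: pr)
      \<comment> \<open>Lowering the differences of \<open>g\<close>, which lie between 1 and
        \<open>n\<close>, by one makes them remainders, so both factor edge labels can be
        recovered.\<close>
      then have "n * (f b - f a - 1) + (g y - g x - 1) = n * (f b' - f a' - 1) + (g y' - g x' - 1)"
        using lt by linarith
      then have "f b - f a - 1 = f b' - f a' - 1" "g y - g x - 1 = g y' - g x' - 1"
        using mult_add_eqD[of n "f b - f a - 1" "g y - g x - 1" "f b' - f a' - 1" "g y' - g x' - 1"]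
          g_B(2)[OF xy(2)] g_B(2)[OF xy'(2)] lt by linarith+
      then have eqs: "f b - f a = f b' - f a'" "g y - g x = g y' - g x'"
        using lt by linarith+
      \<comment> \<open>The edge of \<open>G\<close> has to be recovered first: only then are the
        two remaining edges known to lie in the same graph \<open>H {a, b}\<close>, where equal
        labels mean equal edges.\<close>
      have "a = a'" "b = b'"
        using near_alpha_unique[OF G ab ab' eqs(1)] .
      moreover from this have "x = x'" "y = y'"
        using near_alpha_unique[OF H[OF ab(3)] xy, of x' y'] xy' eqs(2) by auto
      ultimately show ?thesis
        by (simp add: pr)
    qed
  qed (use disj_G near_alpha_parts(3,4)[OF G] near_alpha_parts(3,4)[OF H0] in
      \<open>simp_all add: weak_product_def Times_Int_Times\<close>)
  then show ?thesis
    by (simp add: L_def)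
qed

section \<open>Products with a family of labeled graphs\<close>

theorem theorem5:
  fixes G :: "'a graph" and AG BG :: "'a set" and fG :: "'a \<Rightarrow> nat"
    and n :: nat and A B :: "nat set"
    and \<Gamma> :: "'b graph set"
    and PA PB :: "'b graph \<Rightarrow> 'b set" and fF :: "'b graph \<Rightarrow> 'b \<Rightarrow> nat"
    and h :: "'a set \<Rightarrow> 'b graph"
  assumes "bipartite G"
    and "near_alpha_labeling G AG BG fG"
    and "n \<ge> 1"
    and "A \<subseteq> {0..n}" and "B \<subseteq> {0..n}" and "A \<inter> B = {}"
    and "\<And>F. F \<in> \<Gamma> \<Longrightarrow> bipartite F"
    and "\<And>F. F \<in> \<Gamma> \<Longrightarrow> card (edges F) = n"
    and "\<And>F. F \<in> \<Gamma> \<Longrightarrow> near_alpha_labeling F (PA F) (PB F) (fF F)"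
    and "\<And>F. F \<in> \<Gamma> \<Longrightarrow> fF F ` PA F = A"
    and "\<And>F. F \<in> \<Gamma> \<Longrightarrow> fF F ` PB F = B"
    and "h \<in> edges G \<rightarrow> \<Gamma>"
  shows "admits_near_alpha_labeling
           (weak_product G AG BG A B (\<lambda>e. relabel (fF (h e)) (h e)))"
proof -
  \<comment> \<open>After the identification the common labeling \<open>g\<close> of the product
    construction is the identity.\<close>
  have "near_alpha_labeling (relabel (fF (h e)) (h e)) A B (\<lambda>x. x) \<and>
      card (edges (relabel (fF (h e)) (h e))) = n" if "e \<in> edges G" for e
  proof -
    have F: "h e \<in> \<Gamma>"
      using assms(12) that by blast
    then show ?thesis
      using near_alpha_relabel[OF assms(9)[OF F]] card_edges_relabel[OF assms(9)[OF F]]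
        assms(8,10,11) by simp
  qed
  then have "near_alpha_labeling (weak_product G AG BG A B (\<lambda>e. relabel (fF (h e)) (h e)))
      (AG \<times> A) (BG \<times> B) (\<lambda>(v, x). if v \<in> AG then n * fG v + x else n * (fG v - 1) + x)"
    by (intro near_alpha_weak_product[OF assms(2)]) simp_all
  then show ?thesis
    unfolding admits_near_alpha_labeling_def by (intro exI)
qed

end
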